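(* Let $X$ be a non-negative absolutely continuous random variable with probability density function $f$, and let $Y=aX+b$ with $a>0$ and $b\ge 0$. Put $w_1(x)=ax+b$. Assume all the integrals and expectations below exist and are finite. Then the weighted varentropy of $Y$ with weight $w(y)=y$ is $$VE^{y}(Y)=VE^{w_1}(X)+(a\log a)^2\,\mathrm{Var}(X)+2\log a\,\Big(H^{w_1^2}(X)-H^{w_1}(X)\,E[aX+b]\Big).$$
   Context: Let $Z$ be a non-negative absolutely continuous random variable with density $f_Z$ and let $w\ge 0$ be a weight function on $(0,\infty)$. The weighted Shannon entropy of $Z$ with weight $w$ is $H^{w}(Z)=-\int_0^\infty w(x)f_Z(x)\log f_Z(x)\,dx$. The weighted varentropy of $Z$ with weight $w$ is $$VE^{w}(Z)=\mathrm{Var}[-w(Z)\log f_Z(Z)]=\int_0^\infty w^2(x)f_Z(x)[\log f_Z(x)]^2dx-\Big[\int_0^\infty w(x)f_Z(x)\log f_Z(x)\,dx\Big]^2.$$ $VE^{y}(Y)$ means $VE^{w}(Y)$ with the identity weight $w(y)=y$; $H^{w_1^2}(X)$ is the weighted Shannon entropy with weight $(ax+b)^2$. Here $\log$ is the natural logarithm and $0\log 0=0$. *)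

theory Defs
  imports "HOL-Probability.Probability"
begin

text \<open>
  Below, \<open>f\<close> is a probability density, with respect to Lebesgue measure, of a real random
  variable \<open>Z\<close> that is almost surely non-negative. A density is determined only almost
  everywhere; neither quantity depends on the version chosen.  The convention
  \<open>0 * log 0 = 0\<close> is automatic, since \<open>ln 0 = 0\<close>.
\<close>

definition weighted_entropy :: "(real \<Rightarrow> real) \<Rightarrow> (real \<Rightarrow> real) \<Rightarrow> real" where
  "weighted_entropy w f = - (LINT x:{0<..}|lborel. w x * f x * ln (f x))"

definition weighted_varentropy ::
    "'a measure \<Rightarrow> ('a \<Rightarrow> real) \<Rightarrow> (real \<Rightarrow> real) \<Rightarrow> (real \<Rightarrow> real) \<Rightarrow> real" where
  "weighted_varentropy M Z f w =
    prob_space.variance M (\<lambda>\<omega>. - w (Z \<omega>) * ln (f (Z \<omega>)))"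

lemma (in prob_space) weighted_varentropy_eq_integrals:
  assumes f0: "\<forall>x. 0 \<le> f x"
    and D: "distributed M lborel Z (\<lambda>x. ennreal (f x))"
    and Z0: "AE \<omega> in M. 0 \<le> Z \<omega>"
    and w[measurable]: "w \<in> borel_measurable borel"
    and I1: "set_integrable lborel {0<..} (\<lambda>x. w x * f x * ln (f x))"
    and I2: "set_integrable lborel {0<..} (\<lambda>x. (w x)\<^sup>2 * f x * (ln (f x))\<^sup>2)"
  shows "weighted_varentropy M Z f w =
    (LINT x:{0<..}|lborel. (w x)\<^sup>2 * f x * (ln (f x))\<^sup>2)
      - (LINT x:{0<..}|lborel. w x * f x * ln (f x))\<^sup>2"
proof -
  have [measurable]: "f \<in> borel_measurable borel"
    using distributed_real_measurable[OF _ D] f0 by simp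
  have [measurable]: "Z \<in> borel_measurable M"
    using distributed_measurable[OF D] by simp
  have "AE z in distr M lborel Z. 0 \<le> z"
    using Z0 by (subst AE_distr_iff) auto
  then have "AE x in density lborel (\<lambda>x. ennreal (f x)). 0 \<le> x"
    unfolding distributed_distr_eq_density[OF D] .
  then have *: "AE x in lborel. 0 < ennreal (f x) \<longrightarrow> 0 \<le> x"
    by (subst (asm) AE_density) auto
  have supp: "AE x in lborel. f x \<noteq> 0 \<longrightarrow> 0 < x"
    using * AE_lborel_singleton[of 0]
  proof eventually_elim
    case (elim x)
    then show ?case using f0[rule_format, of x] by (auto simp: less_le)
  qed
  have ae1: "AE x in lborel.
      f x * (w x * ln (f x)) = indicator {0<..} x *\<^sub>R (w x * f x * ln (f x))"
    using supp by eventually_elim (auto simp: indicator_def)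
  have ae2: "AE x in lborel.
      f x * (w x * ln (f x))\<^sup>2 = indicator {0<..} x *\<^sub>R ((w x)\<^sup>2 * f x * (ln (f x))\<^sup>2)"
    using supp by eventually_elim (auto simp: indicator_def power_mult_distrib)
  let ?g = "\<lambda>x. w x * ln (f x)"
  have i1: "integrable lborel (\<lambda>x. f x * ?g x)"
    using I1 integrable_cong_AE[OF _ _ ae1] by (simp add: set_integrable_def)
  have i2: "integrable lborel (\<lambda>x. f x * (?g x)\<^sup>2)"
    using I2 integrable_cong_AE[OF _ _ ae2] by (simp add: set_integrable_def)
  have e1: "(\<integral>x. f x * ?g x \<partial>lborel) = (LINT x:{0<..}|lborel. w x * f x * ln (f x))"
    unfolding set_lebesgue_integral_def by (rule integral_cong_AE[OF _ _ ae1]) simp_all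
  have e2: "(\<integral>x. f x * (?g x)\<^sup>2 \<partial>lborel)
      = (LINT x:{0<..}|lborel. (w x)\<^sup>2 * f x * (ln (f x))\<^sup>2)"
    unfolding set_lebesgue_integral_def by (rule integral_cong_AE[OF _ _ ae2]) simp_all
  have j1: "integrable M (\<lambda>\<omega>. ?g (Z \<omega>))" and j2: "integrable M (\<lambda>\<omega>. (?g (Z \<omega>))\<^sup>2)"
    using i1 i2 distributed_integrable[OF D, of ?g]
      distributed_integrable[OF D, of "\<lambda>x. (?g x)\<^sup>2"] f0 by simp_all
  have k1: "expectation (\<lambda>\<omega>. ?g (Z \<omega>)) = (\<integral>x. f x * ?g x \<partial>lborel)"
    using distributed_integral[OF D, of ?g] f0 by simp
  have k2: "expectation (\<lambda>\<omega>. (?g (Z \<omega>))\<^sup>2) = (\<integral>x. f x * (?g x)\<^sup>2 \<partial>lborel)"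
    using distributed_integral[OF D, of "\<lambda>x. (?g x)\<^sup>2"] f0 by simp
  have "weighted_varentropy M Z f w = variance (\<lambda>\<omega>. - ?g (Z \<omega>))"
    by (simp add: weighted_varentropy_def)
  also have "\<dots> = expectation (\<lambda>\<omega>. (?g (Z \<omega>))\<^sup>2) - (expectation (\<lambda>\<omega>. ?g (Z \<omega>)))\<^sup>2"
    using variance_eq[of "\<lambda>\<omega>. - ?g (Z \<omega>)"] j1 j2 by simp
  finally show ?thesis by (simp only: k1 k2 e1 e2)
qed

end

theory Submission
  imports Defs
begin

text \<open>
  If \<open>Y = a X + b\<close>, then almost surely \<open>g(Y) = f(X) / a\<close>, so that
  \<open>-Y log g(Y) = -w\<^sub>1(X) log f(X) + (log a) w\<^sub>1(X)\<close>. The variance of this sum is expanded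
  bilinearly; the covariance term is the difference of entropies in the claim.
\<close>

context prob_space
begin

text \<open>This is bilinearity of the covariance: the last bracket is the covariance of
  \<open>U\<close> and \<open>W\<close>. It is applied with \<open>c = ln a\<close>, where
  \<open>W\<close> is \<open>w1\<close> evaluated at \<open>X\<close> and \<open>U\<close> is the
  variable whose variance is the weighted varentropy of \<open>X\<close>.\<close>

lemma variance_add_cmult:
  fixes U W :: "'a \<Rightarrow> real"
  assumes U: "integrable M U" and U2: "integrable M (\<lambda>\<omega>. (U \<omega>)\<^sup>2)"
    and W: "integrable M W" and W2: "integrable M (\<lambda>\<omega>. (W \<omega>)\<^sup>2)"
    and UW: "integrable M (\<lambda>\<omega>. U \<omega> * W \<omega>)"
  shows "variance (\<lambda>\<omega>. U \<omega> + c * W \<omega>) = variance U + c\<^sup>2 * variance W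
    + 2 * c * (expectation (\<lambda>\<omega>. U \<omega> * W \<omega>) - expectation U * expectation W)"
proof -
  have sq: "(\<lambda>\<omega>. (U \<omega> + c * W \<omega>)\<^sup>2) = (\<lambda>\<omega>. (U \<omega>)\<^sup>2 + (c\<^sup>2 * (W \<omega>)\<^sup>2 + 2 * c * (U \<omega> * W \<omega>)))"
    by (simp add: fun_eq_iff power2_eq_square algebra_simps)
  have var: "variance (\<lambda>\<omega>. U \<omega> + c * W \<omega>)
      = expectation (\<lambda>\<omega>. (U \<omega> + c * W \<omega>)\<^sup>2) - (expectation (\<lambda>\<omega>. U \<omega> + c * W \<omega>))\<^sup>2"
    by (rule variance_eq) (use assms in \<open>simp_all add: sq\<close>)
  have mean_sq: "expectation (\<lambda>\<omega>. (U \<omega> + c * W \<omega>)\<^sup>2) = expectation (\<lambda>\<omega>. (U \<omega>)\<^sup>2)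
      + (c\<^sup>2 * expectation (\<lambda>\<omega>. (W \<omega>)\<^sup>2) + 2 * c * expectation (\<lambda>\<omega>. U \<omega> * W \<omega>))"
    using U2 W2 UW by (simp add: sq)
  have mean: "expectation (\<lambda>\<omega>. U \<omega> + c * W \<omega>) = expectation U + c * expectation W"
    using U W by simp
  show ?thesis
    \<comment> \<open>Two stages are used because \<open>mean\<close> would also rewrite the
      expectation inside the centred square, after which \<open>var\<close> would no longer
      match.\<close>
    unfolding var variance_eq[OF U U2] variance_eq[OF W W2] unfolding mean mean_sq
    by (simp add: power2_eq_square algebra_simps)
qed

lemma variance_affine:
  fixes X :: "'a \<Rightarrow> real"
  assumes "integrable M X"
  shows "variance (\<lambda>\<omega>. a * X \<omega> + b) = a\<^sup>2 * variance X"
proof -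
  have "expectation (\<lambda>\<omega>. a * X \<omega> + b) = a * expectation X + b"
    using assms by (simp add: prob_space)
  then have "(\<lambda>\<omega>. (a * X \<omega> + b - expectation (\<lambda>\<omega>. a * X \<omega> + b))\<^sup>2)
      = (\<lambda>\<omega>. a\<^sup>2 * (X \<omega> - expectation X)\<^sup>2)"
    by (simp add: fun_eq_iff power2_eq_square algebra_simps)
  then show ?thesis by simp
qed

text \<open>Almost sure non-negativity of \<open>X\<close> forces the density to vanish almost
  everywhere on the negative half-line, and the point 0 is a Lebesgue null set. This bridges
  integrals over the open half-line and integrals over all reals.\<close>

lemma nonneg_distributed_AE_support:
  assumes f0: "\<And>x::real. 0 \<le> f x"
    and D: "distributed M lborel X (\<lambda>x. ennreal (f x))"
    and X0: "AE \<omega> in M. 0 \<le> X \<omega>"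
  shows "AE x in lborel. f x \<noteq> 0 \<longrightarrow> 0 < x"
proof -
  have "AE x in lborel. 0 < ennreal (f x) \<longrightarrow> 0 \<le> x"
    using X0 by (subst (asm) distributed_AE2[OF D]) auto
  with AE_lborel_singleton[of 0] show ?thesis
  proof eventually_elim
    case (elim x)
    then show ?case using f0[of x] by (auto simp: less_le)
  qed
qed

text \<open>Since \<open>f\<close> vanishes almost everywhere off the open half-line, restricting
  the integral changes nothing, and integrating against the density is taking an expectation. All
  entropy integrals of \<open>X\<close> thus move to the probability space.\<close>

lemma
  fixes h :: "real \<Rightarrow> real"
  assumes f0: "\<And>x. 0 \<le> f x"
    and D: "distributed M lborel X (\<lambda>x. ennreal (f x))"
    and X0: "AE \<omega> in M. 0 \<le> X \<omega>"
    and h[measurable]: "h \<in> borel_measurable borel"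
  shows nonneg_distributed_integrable:
      "set_integrable lborel {0<..} (\<lambda>x. f x * h x) \<longleftrightarrow> integrable M (\<lambda>\<omega>. h (X \<omega>))" (is ?I)
    and nonneg_distributed_integral:
      "(LINT x:{0<..}|lborel. f x * h x) = expectation (\<lambda>\<omega>. h (X \<omega>))" (is ?E)
proof -
  have [measurable]: "f \<in> borel_measurable borel"
    using distributed_real_measurable[OF _ D] f0 by simp
  have ae: "AE x in lborel. indicator {0<..} x *\<^sub>R (f x * h x) = f x * h x"
    using nonneg_distributed_AE_support[OF f0 D X0]
    by eventually_elim (auto simp: indicator_def)
  have "set_integrable lborel {0<..} (\<lambda>x. f x * h x) \<longleftrightarrow> integrable lborel (\<lambda>x. f x * h x)"
    unfolding set_integrable_def by (rule integrable_cong_AE[OF _ _ ae]) simp_all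
  also have "\<dots> \<longleftrightarrow> integrable M (\<lambda>\<omega>. h (X \<omega>))"
    using distributed_integrable[OF D, of h] f0 by simp
  finally show ?I .
  have "(LINT x:{0<..}|lborel. f x * h x) = (\<integral>x. f x * h x \<partial>lborel)"
    unfolding set_lebesgue_integral_def by (rule integral_cong_AE[OF _ _ ae]) simp_all
  also have "\<dots> = expectation (\<lambda>\<omega>. h (X \<omega>))"
    using distributed_integral[OF D, of h] f0 by simp
  finally show ?E .
qed

text \<open>The change of variables gives one density of \<open>aX + b\<close>, while
  \<open>g\<close> is an arbitrary version of it. Uniqueness of densities identifies the two only
  almost everywhere, so the relation holds only almost surely.\<close>

lemma AE_density_affine:
  fixes X :: "'a \<Rightarrow> real"
  assumes f0: "\<And>x. 0 \<le> f x" and DX: "distributed M lborel X (\<lambda>x. ennreal (f x))"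
    and g0: "\<And>y. 0 \<le> g y" and DY: "distributed M lborel (\<lambda>\<omega>. a * X \<omega> + b) (\<lambda>y. ennreal (g y))"
    and a: "a > 0"
  shows "AE \<omega> in M. g (a * X \<omega> + b) = f (X \<omega>) / a"
proof -
  have [measurable]: "f \<in> borel_measurable borel" "g \<in> borel_measurable borel"
    using distributed_real_measurable[OF _ DX] distributed_real_measurable[OF _ DY] f0 g0 by simp_all
  have "distributed M lborel (\<lambda>\<omega>. b + a * X \<omega>) (\<lambda>y. ennreal (f ((y - b) / a)) / \<bar>a\<bar>)"
    by (rule distributed_affine[OF DX]) (use a in simp)
  then have "distributed M lborel (\<lambda>\<omega>. a * X \<omega> + b) (\<lambda>y. ennreal (f ((y - b) / a) / a))"
    using a f0 by (simp add: add.commute divide_ennreal)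
  then have "AE y in lborel. ennreal (g y) = ennreal (f ((y - b) / a) / a)"
    by (rule distributed_unique[OF DY])
  \<comment> \<open>Both sides are non-negative, so equality descends from \<open>ennreal\<close> to
    the reals. The guard \<open>0 < ennreal (g y)\<close> is the form in which
    \<open>distributed_AE2\<close> carries a property of almost every \<open>y\<close> over to the
    values of the random variable.\<close>
  then have "AE y in lborel. 0 < ennreal (g y) \<longrightarrow> g y = f ((y - b) / a) / a"
    by (rule eventually_mono) (use a f0 g0 in simp)
  then have "AE \<omega> in M. g (a * X \<omega> + b) = f ((a * X \<omega> + b - b) / a) / a"
    by (subst distributed_AE2[OF DY]) auto
  then show ?thesis using a by simp
qed

end

theorem proposition2p1:
  fixes M :: "'a measure" and X Y :: "'a \<Rightarrow> real" and f g w1 :: "real \<Rightarrow> real"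
    and a b :: real
  assumes "prob_space M"
    and "AE \<omega> in M. 0 \<le> X \<omega>"
    and "\<forall>x. 0 \<le> f x" and "distributed M lborel X (\<lambda>x. ennreal (f x))"
    and "a > 0" and "b \<ge> 0"
    and "Y = (\<lambda>\<omega>. a * X \<omega> + b)"
    and "\<forall>y. 0 \<le> g y" and "distributed M lborel Y (\<lambda>y. ennreal (g y))"
    and "w1 = (\<lambda>x. a * x + b)"
    and "set_integrable lborel {0<..} (\<lambda>y. y * g y * ln (g y))"
    and "set_integrable lborel {0<..} (\<lambda>y. y\<^sup>2 * g y * (ln (g y))\<^sup>2)"
    and "set_integrable lborel {0<..} (\<lambda>x. w1 x * f x * ln (f x))"
    and "set_integrable lborel {0<..} (\<lambda>x. (w1 x)\<^sup>2 * f x * (ln (f x))\<^sup>2)"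
    and "set_integrable lborel {0<..} (\<lambda>x. (w1 x)\<^sup>2 * f x * ln (f x))"
    and "integrable M X" and "integrable M (\<lambda>\<omega>. (X \<omega>)\<^sup>2)"
  shows "weighted_varentropy M Y g (\<lambda>y. y) =
    weighted_varentropy M X f w1 + (a * ln a)\<^sup>2 * prob_space.variance M X
      + 2 * ln a * (weighted_entropy (\<lambda>x. (w1 x)\<^sup>2) f
          - weighted_entropy w1 f * prob_space.expectation M (\<lambda>\<omega>. a * X \<omega> + b))"
proof -
  interpret prob_space M by fact
  note X0 = assms(2) and DX = assms(4) and a = assms(5) and X = assms(16) and X2 = assms(17)
  have f0: "\<And>x. 0 \<le> f x" and g0: "\<And>y. 0 \<le> g y" using assms(3,8) by auto
  have [measurable]: "f \<in> borel_measurable borel" "g \<in> borel_measurable borel"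
      "X \<in> borel_measurable M" "w1 \<in> borel_measurable borel"
    using distributed_real_measurable[OF _ DX] distributed_real_measurable[OF _ assms(9)]
      distributed_measurable[OF DX] f0 g0 assms(10) by simp_all
  define U W where "U = (\<lambda>\<omega>. - w1 (X \<omega>) * ln (f (X \<omega>)))" and "W = (\<lambda>\<omega>. w1 (X \<omega>))"
  have [measurable]: "U \<in> borel_measurable M" "W \<in> borel_measurable M"
    by (simp_all add: U_def W_def)
  \<comment> \<open>The identity weight evaluated at \<open>Y\<close> is therefore \<open>w1\<close>
    evaluated at \<open>X\<close>.\<close>
  have Y: "Y = W" and W_eq: "W = (\<lambda>\<omega>. a * X \<omega> + b)"
    using assms(7,10) by (simp_all add: W_def)

  note integrable_X = nonneg_distributed_integrable[OF f0 DX X0]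
    and integral_X = nonneg_distributed_integral[OF f0 DX X0]
  have intU: "integrable M U"
    using assms(13) integrable_X[of "\<lambda>x. w1 x * ln (f x)"] by (simp add: U_def mult_ac)
  have intU2: "integrable M (\<lambda>\<omega>. (U \<omega>)\<^sup>2)"
    using assms(14) integrable_X[of "\<lambda>x. (w1 x)\<^sup>2 * (ln (f x))\<^sup>2"]
    by (simp add: U_def power_mult_distrib mult_ac)
  have intUW: "integrable M (\<lambda>\<omega>. U \<omega> * W \<omega>)"
    using assms(15) integrable_X[of "\<lambda>x. (w1 x)\<^sup>2 * ln (f x)"]
    by (simp add: U_def W_def power2_eq_square mult_ac)
  have intW: "integrable M W" using X by (simp add: W_eq)
  have "(\<lambda>\<omega>. (W \<omega>)\<^sup>2) = (\<lambda>\<omega>. a\<^sup>2 * (X \<omega>)\<^sup>2 + 2 * a * b * X \<omega> + b\<^sup>2)"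
    by (simp add: W_eq fun_eq_iff power2_eq_square algebra_simps)
  then have intW2: "integrable M (\<lambda>\<omega>. (W \<omega>)\<^sup>2)" using X X2 by simp

  \<comment> \<open>The minus sign in the entropy is the one built into \<open>U\<close>. As the
    product of \<open>U\<close> and \<open>W\<close> carries the squared weight, the covariance of
    \<open>U\<close> and \<open>W\<close> is exactly the entropy difference in the claim.\<close>
  have EU: "weighted_entropy w1 f = expectation U"
    using integral_X[of "\<lambda>x. w1 x * ln (f x)"]
    by (simp add: weighted_entropy_def U_def mult_ac)
  have EUW: "weighted_entropy (\<lambda>x. (w1 x)\<^sup>2) f = expectation (\<lambda>\<omega>. U \<omega> * W \<omega>)"
    using integral_X[of "\<lambda>x. (w1 x)\<^sup>2 * ln (f x)"]
    by (simp add: weighted_entropy_def U_def W_def power2_eq_square mult_ac)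

  have "AE \<omega> in M. g (W \<omega>) = f (X \<omega>) / a"
    using AE_density_affine[OF f0 DX g0 _ a] assms(9) by (simp add: Y W_eq)
  \<comment> \<open>Positivity is essential for splitting the logarithm of the quotient: with
    \<open>ln 0 = 0\<close>, the rule \<open>ln (f / a) = ln f - ln a\<close> fails at
    \<open>f = 0\<close> unless \<open>a = 1\<close>.\<close>
  moreover have "AE \<omega> in M. f (X \<omega>) > 0"
    by (subst distributed_AE2[OF DX]) auto
  ultimately have ae: "AE \<omega> in M. - W \<omega> * ln (g (W \<omega>)) = U \<omega> + ln a * W \<omega>"
  proof eventually_elim
    case (elim \<omega>)
    then show ?case using a by (simp add: ln_div U_def W_def algebra_simps)
  qed
  \<comment> \<open>The variance contains the mean inside its integrand, so the two means are
    identified before the almost sure equality is applied to the centred squares.\<close>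
  have mean: "expectation (\<lambda>\<omega>. - W \<omega> * ln (g (W \<omega>))) = expectation (\<lambda>\<omega>. U \<omega> + ln a * W \<omega>)"
    by (rule integral_cong_AE[OF _ _ ae]) simp_all
  have "weighted_varentropy M Y g (\<lambda>y. y) = variance (\<lambda>\<omega>. U \<omega> + ln a * W \<omega>)"
    unfolding weighted_varentropy_def Y mean
    by (rule integral_cong_AE) (use ae in \<open>auto elim: eventually_mono\<close>)
  also have "\<dots> = variance U + (ln a)\<^sup>2 * variance W
      + 2 * ln a * (expectation (\<lambda>\<omega>. U \<omega> * W \<omega>) - expectation U * expectation W)"
    by (rule variance_add_cmult[OF intU intU2 intW intW2 intUW])
  also have "variance U = weighted_varentropy M X f w1"
    by (simp add: weighted_varentropy_def U_def)
  also have "(ln a)\<^sup>2 * variance W = (a * ln a)\<^sup>2 * variance X"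
    by (simp add: W_eq variance_affine[OF X] power_mult_distrib)
  finally show ?thesis by (simp only: EU EUW W_eq)
qed

end
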